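(* Let $\delta=1$, $\tau=\frac{\mu}{L}\neq1$, and let $\beta,\lambda$ satisfy $$\max\Big\{\frac{5\tau^2-4}{2\tau^2},0\Big\}<\beta<\frac12,\qquad0<\lambda<\frac{\tau}{2}\Big(\frac{\mu}{2\rho}\Big)^{1/\nu}.$$ For an initial point $x_0\in\mathcal{T}_{1/2}$ set $$q:=\sqrt{1-\frac{(1-2\beta)\tau^2}{4}},\qquad A:=\max\Big\{\frac{2\lambda}{\tau},\operatorname{dist}(x_0;\mathcal{X}^* )\Big\}.$$ Let $\{x_k\}_{k\ge0}$ be generated by the projected subgradient method with step-size $\alpha_k=\lambda q^k$ and initial point $x_0\in\mathcal{T}_{1/2}$ satisfying $$\operatorname{dist}(x_0;\mathcal{X}^* )\le\frac{2\lambda}{\tau-\sqrt{\tau^2-4(1-q^2)}}.$$ Then, for all $k\ge0$, $$\operatorname{dist}(x_k;\mathcal{X}^* )\le Aq^k.$$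
   Context: $\|\cdot\|$ is the Euclidean norm on $\mathbb{R}^n$, $\operatorname{dist}(x;S)=\inf_{z\in S}\|z-x\|$, $\operatorname{proj}_X$ is the Euclidean projection onto $X$, $\operatorname{dom}(f)=\{x:f(x)<+\infty\}$, and $\partial f$ is the Clarke subdifferential. Standing assumptions: $f:\mathbb{R}^n\to\mathbb{R}\cup\{+\infty\}$ is proper; $X\subseteq\operatorname{dom}(f)$ is nonempty, closed and convex; the set of minimizers $\mathcal{X}^*=\operatorname{argmin}_{x\in X}f(x)$ is nonempty and $f^*$ is the minimal value of $f$ over $X$. The parameters satisfy $\rho>0$, $0<\nu\le1$, $\frac1{1+\nu}<\delta\le1$, $\mu>0$ (here the claim takes $\delta=1$), and: (i) $f$ is $\nu$-paraconvex with constant $\rho$ on an open convex set $X'$ with $X\subseteq X'\subseteq\operatorname{dom}(f)$, i.e. $f(\lambda x+(1-\lambda)y)\le\lambda f(x)+(1-\lambda)f(y)+\rho\min\{\lambda,1-\lambda\}\|x-y\|^{1+\nu}$ for all $x,y\in X'$, $\lambda\in[0,1]$ (consequently $f$ is locally Lipschitz on $X'$); (ii) Hölderian error bound: $\mu\operatorname{dist}^{1/\delta}(x;\mathcal{X}^* )\le f(x)-f^*$ for all $x\in X$. For $\gamma\in(0,1]$ let $\mathcal{T}_\gamma=\big\{x\in X:\operatorname{dist}(x;\mathcal{X}^* )<(\gamma\mu/\rho)^{\delta/(\delta(1+\nu)-1)}\big\}$. Let $L=\sup\{\|\zeta\|:\zeta\in\partial f(x),\ x\in\mathcal{T}_1\}$,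 with $0<L<\infty$. Projected subgradient method with step-sizes $\alpha_k$: from the initial point, at each iteration choose any $\zeta_k\in\partial f(x_k)$ and set $x_{k+1}=\operatorname{proj}_X\big(x_k-\alpha_k\zeta_k/\|\zeta_k\|\big)$; if $\zeta_k=0$, set $x_{k+1}=x_k$. *)

theory Defs
  imports "HOL-Analysis.Analysis"
begin

definition effective_domain :: "('a \<Rightarrow> ereal) \<Rightarrow> 'a set" where
  "effective_domain f = {x. f x < \<infinity>}"

definition proper_fun :: "('a \<Rightarrow> ereal) \<Rightarrow> bool" where
  "proper_fun f \<longleftrightarrow> (\<forall>x. f x \<noteq> -\<infinity>) \<and> effective_domain f \<noteq> {}"

definition minimizers :: "('a \<Rightarrow> ereal) \<Rightarrow> 'a set \<Rightarrow> 'a set" where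
  "minimizers f X = {x. is_arg_min f (\<lambda>z. z \<in> X) x}"

definition min_value :: "('a \<Rightarrow> ereal) \<Rightarrow> 'a set \<Rightarrow> ereal" where
  "min_value f X = (INF x\<in>X. f x)"

definition paraconvex_on ::
  "'a::real_normed_vector set \<Rightarrow> real \<Rightarrow> real \<Rightarrow> ('a \<Rightarrow> ereal) \<Rightarrow> bool" where
  "paraconvex_on S \<nu> \<rho> f \<longleftrightarrow>
    (\<forall>x\<in>S. \<forall>y\<in>S. \<forall>t\<in>{0..1}.
      f (t *\<^sub>R x + (1 - t) *\<^sub>R y)
        \<le> ereal t * f x + ereal (1 - t) * f y
          + ereal (\<rho> * min t (1 - t) * norm (x - y) powr (1 + \<nu>)))"

definition holder_error_bound ::
  "('a::metric_space \<Rightarrow> ereal) \<Rightarrow> 'a set \<Rightarrow> real \<Rightarrow> real \<Rightarrow> bool" where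
  "holder_error_bound f X \<delta> \<mu> \<longleftrightarrow>
    (\<forall>x\<in>X. ereal (\<mu> * infdist x (minimizers f X) powr (1 / \<delta>)) \<le> f x - min_value f X)"

text \<open>Clarke's generalized directional derivative
  \<open>limsup (f (y + t v) - f y) / t\<close> as \<open>y \<rightarrow> x\<close> and \<open>t \<down> 0\<close>; the base point
  \<open>y\<close> may equal \<open>x\<close>, hence \<open>nhds x\<close> and not \<open>at x\<close>. This is the definition for functions
  that are finite and Lipschitz near \<open>x\<close>. It is only used at points of an
  open set on which \<open>f\<close> is locally Lipschitz.\<close>

definition clarke_dd :: "('a::real_normed_vector \<Rightarrow> ereal) \<Rightarrow> 'a \<Rightarrow> 'a \<Rightarrow> ereal" where
  "clarke_dd f x v =
    Limsup (nhds x \<times>\<^sub>F at_right 0) (\<lambda>(y, t). (f (y + t *\<^sub>R v) - f y) / ereal t)"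

definition clarke_subdiff :: "('a::real_inner \<Rightarrow> ereal) \<Rightarrow> 'a \<Rightarrow> 'a set" where
  "clarke_subdiff f x = {\<zeta>. \<forall>v. ereal (\<zeta> \<bullet> v) \<le> clarke_dd f x v}"

definition tube ::
  "('a::metric_space \<Rightarrow> ereal) \<Rightarrow> 'a set \<Rightarrow> real \<Rightarrow> real \<Rightarrow> real \<Rightarrow> real \<Rightarrow> real \<Rightarrow> 'a set" where
  "tube f X \<nu> \<rho> \<delta> \<mu> \<gamma> =
    {x \<in> X. infdist x (minimizers f X) < (\<gamma> * \<mu> / \<rho>) powr (\<delta> / (\<delta> * (1 + \<nu>) - 1))}"

text \<open>The sequence \<open>x\<close> is a run of the projected subgradient method with step-sizes \<open>\<alpha>\<close>;
  the subgradients are chosen arbitrarily at each iteration. On a nonempty closed convex set,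
  \<^const>\<open>closest_point\<close> is the Euclidean projection.\<close>

definition projected_subgradient ::
  "('a::euclidean_space \<Rightarrow> ereal) \<Rightarrow> 'a set \<Rightarrow> (nat \<Rightarrow> real) \<Rightarrow> (nat \<Rightarrow> 'a) \<Rightarrow> bool" where
  "projected_subgradient f X \<alpha> x \<longleftrightarrow>
    (\<forall>k. \<exists>\<zeta> \<in> clarke_subdiff f (x k).
      x (Suc k) = (if \<zeta> = 0 then x k
                   else closest_point X (x k - (\<alpha> k / norm \<zeta>) *\<^sub>R \<zeta>)))"

end

theory Submission imports Defs begin

text \<open>
  The proof compares the projected subgradient step with a nearest minimizer. Let \<open>d\<close> be the
  distance from an iterate \<open>x\<close> to the set of minimizers and let \<open>p\<close> be a minimizer with
  \<open>\<parallel>x - p\<parallel> = d\<close>. For a Clarke subgradient \<open>\<zeta>\<close> at \<open>x\<close>, paraconvexity gives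
  \<open>\<zeta> \<bullet> (x - p) \<ge> f x - f p - \<rho> d\<^sup>1\<^sup>+\<^sup>\<nu>\<close> (\<open>paraconvex_subgradient_inequality\<close>), and the error bound
  with \<open>\<delta> = 1\<close> makes the right-hand side at least \<open>\<mu> d - \<rho> d\<^sup>1\<^sup>+\<^sup>\<nu>\<close>. In the half tube, where
  \<open>\<rho> d\<^sup>\<nu> \<le> \<mu> / 2\<close>, this is at least \<open>\<mu> d / 2\<close>. Since the projection is nonexpansive and
  \<open>\<parallel>\<zeta>\<parallel> \<le> L\<close>, expanding the square of the next distance gives
  \<open>d'\<^sup>2 \<le> d\<^sup>2 - \<tau> \<alpha> d + \<alpha>\<^sup>2\<close> (\<open>infdist_projected_step_le\<close>).

  For \<open>\<alpha> = \<lambda> q\<^sup>k\<close> the right-hand side is convex in \<open>d\<close>, so on \<open>[0, A q\<^sup>k]\<close> it is maximal at an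
  endpoint, and the induction step \<open>d' \<le> A q\<^sup>k\<^sup>+\<^sup>1\<close> reduces to the inequalities
  \<open>\<lambda>\<^sup>2 \<le> A\<^sup>2 q\<^sup>2\<close> and \<open>A\<^sup>2 - \<tau> \<lambda> A + \<lambda>\<^sup>2 \<le> A\<^sup>2 q\<^sup>2\<close>. The first one follows from \<open>A \<ge> 2 \<lambda> / \<tau>\<close>
  and the lower bound on \<open>\<beta>\<close>. The second one says that \<open>A\<close> lies between the roots
  \<open>2 \<lambda> / (\<tau> \<plusminus> sqrt (\<tau>\<^sup>2 - 4 (1 - q\<^sup>2)))\<close> of a quadratic: the smaller root is at most
  \<open>2 \<lambda> / \<tau>\<close>, and the bound on the initial distance keeps \<open>A\<close> below the larger one
  (\<open>geometric_rate_conditions\<close>). The bounds on \<open>\<lambda>\<close> and on \<open>x 0\<close> make \<open>A\<close> smaller than the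
  radius of the half tube, so all iterates stay inside it.

  A finite paraconvex function on an open set is continuous (\<open>paraconvex_continuous_on\<close>). This is
  used twice: to bound the limit superior in the Clarke derivative, whose base points vary, and to
  see that the set of minimizers is closed, so that a nearest \<open>p\<close> exists.
\<close>

section \<open>Continuity of paraconvex functions\<close>

lemma paraconvex_on_realD:
  fixes g :: "'a::real_normed_vector \<Rightarrow> real"
  assumes "paraconvex_on S \<nu> \<rho> (\<lambda>z. ereal (g z))" "x \<in> S" "y \<in> S" "0 \<le> t" "t \<le> 1"
  shows "g (t *\<^sub>R x + (1 - t) *\<^sub>R y)
          \<le> t * g x + (1 - t) * g y + \<rho> * min t (1 - t) * norm (x - y) powr (1 + \<nu>)"
  using assms unfolding paraconvex_on_def by auto

lemma paraconvex_on_real_of_ereal: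
  assumes "paraconvex_on S \<nu> \<rho> f" "convex S" "\<And>z. z \<in> S \<Longrightarrow> \<bar>f z\<bar> \<noteq> \<infinity>"
  shows "paraconvex_on S \<nu> \<rho> (\<lambda>z. ereal (real_of_ereal (f z)))"
  unfolding paraconvex_on_def
proof (intro ballI)
  fix x y t assume xyt: "x \<in> S" "y \<in> S" "t \<in> {0..1::real}"
  then have "t *\<^sub>R x + (1 - t) *\<^sub>R y \<in> S"
    using assms(2) by (auto intro: convexD)
  then have "ereal (real_of_ereal (f (t *\<^sub>R x + (1 - t) *\<^sub>R y))) = f (t *\<^sub>R x + (1 - t) *\<^sub>R y)"
    "ereal (real_of_ereal (f x)) = f x" "ereal (real_of_ereal (f y)) = f y"
    using assms(3) xyt by (auto simp: ereal_real')
  then show "ereal (real_of_ereal (f (t *\<^sub>R x + (1 - t) *\<^sub>R y)))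
        \<le> ereal t * ereal (real_of_ereal (f x)) + ereal (1 - t) * ereal (real_of_ereal (f y))
          + ereal (\<rho> * min t (1 - t) * norm (x - y) powr (1 + \<nu>))"
    using assms(1) xyt unfolding paraconvex_on_def by simp
qed

text \<open>A point of the hull of \<open>insert a T\<close> lies on a segment from \<open>a\<close> to the hull of \<open>T\<close>. Each
  added vertex therefore costs one use of paraconvexity, whose error term is bounded because the
  hull of a finite set is bounded.\<close>

lemma paraconvex_bounded_above_on_convex_hull:
  fixes g :: "'a::euclidean_space \<Rightarrow> real"
  assumes "finite T" "paraconvex_on S \<nu> \<rho> (\<lambda>z. ereal (g z))" "\<rho> \<ge> 0" "\<nu> \<ge> 0"
    and "convex hull T \<subseteq> S"
  shows "\<exists>B. \<forall>z\<in>convex hull T. g z \<le> B"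
  using assms(1,5)
proof (induction T)
  case empty
  then show ?case by simp
next
  case (insert a T)
  have sub: "convex hull T \<subseteq> convex hull (insert a T)"
    by (rule hull_mono) auto
  then obtain B where B: "\<And>z. z \<in> convex hull T \<Longrightarrow> g z \<le> B"
    using insert by blast
  have "bounded (convex hull T)"
    using insert.hyps by (simp add: finite_imp_bounded bounded_convex_hull)
  then obtain D where D: "\<And>z. z \<in> convex hull T \<Longrightarrow> dist a z \<le> D"
    unfolding bounded_any_center[where a=a] by blast
  have aS: "a \<in> S" using insert.prems hull_inc[of a "insert a T"] by auto
  show ?case
  proof (cases "T = {}")
    case True
    then show ?thesis by auto
  next
    case False
    have "g z \<le> max (g a) B + \<rho> * D powr (1 + \<nu>)" if z_hull: "z \<in> convex hull (insert a T)" for z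
    proof -
      obtain u v b where uv: "0 \<le> u" "0 \<le> v" "u + v = 1" "b \<in> convex hull T"
        and z: "z = u *\<^sub>R a + v *\<^sub>R b"
        using z_hull unfolding convex_hull_insert[OF False] by blast
      have v: "v = 1 - u" using uv by simp
      have "g z \<le> u * g a + v * g b + \<rho> * min u v * norm (a - b) powr (1 + \<nu>)"
        unfolding z v using paraconvex_on_realD[OF assms(2) aS, of b u] uv insert.prems sub by auto
      also have "u * g a + v * g b \<le> u * max (g a) B + v * max (g a) B"
        using uv B[of b] by (intro add_mono mult_left_mono) auto
      also have "\<dots> = max (g a) B" using uv by (simp flip: distrib_right)
      also have "\<rho> * min u v * norm (a - b) powr (1 + \<nu>) \<le> \<rho> * 1 * D powr (1 + \<nu>)"
        using uv D[of b] assms(3,4)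
        by (intro mult_mono powr_mono2) (auto simp: dist_norm)
      finally show ?thesis by simp
    qed
    then show ?thesis by blast
  qed
qed

text \<open>As for convex functions, an upper bound near \<open>x\<close> yields a two-sided estimate: \<open>y\<close> lies between
  \<open>x\<close> and the point \<open>z\<close> at distance \<open>r\<close> in the direction of \<open>y\<close>, and \<open>x\<close> lies between \<open>y\<close> and the
  reflection \<open>w\<close> of \<open>z\<close> in \<open>x\<close>. The factor \<open>min t (1 - t) \<le> t\<close> makes the error term linear
  in \<open>t\<close>.\<close>

lemma paraconvex_local_lipschitz_at:
  fixes g :: "'a::real_normed_vector \<Rightarrow> real"
  assumes pc: "paraconvex_on S \<nu> \<rho> (\<lambda>z. ereal (g z))" and "\<rho> \<ge> 0" "\<nu> \<ge> 0"
    and r: "r > 0" "cball x r \<subseteq> S" and B: "\<And>z. z \<in> cball x r \<Longrightarrow> g z \<le> B"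
    and y: "y \<in> cball x r"
  shows "\<bar>g y - g x\<bar> \<le> norm (y - x) / r * (B - g x + \<rho> * (2 * r) powr (1 + \<nu>))"
proof (cases "y = x")
  case True
  then show ?thesis by simp
next
  case False
  define t where "t = norm (y - x) / r"
  have t: "0 < t" "t \<le> 1" using False r y by (auto simp: t_def dist_norm norm_minus_commute)
  have nt: "norm (y - x) = t * r" using r by (simp add: t_def)
  define z where "z = x + (1 / t) *\<^sub>R (y - x)"
  define w where "w = x - (1 / t) *\<^sub>R (y - x)"
  have zw: "z \<in> cball x r" "w \<in> cball x r"
    using t nt by (auto simp: z_def w_def dist_norm)
  have x: "x \<in> cball x r" using r by simp
  have K: "r powr (1 + \<nu>) \<le> (2 * r) powr (1 + \<nu>)"
    using r assms by (intro powr_mono2) auto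
  have yeq: "y = t *\<^sub>R z + (1 - t) *\<^sub>R x"
    using t by (simp add: z_def algebra_simps)
  have "norm (z - x) = r" using t nt by (simp add: z_def)
  then have "g y \<le> t * g z + (1 - t) * g x + \<rho> * min t (1 - t) * r powr (1 + \<nu>)"
    using paraconvex_on_realD[OF pc subsetD[OF r(2) zw(1)] subsetD[OF r(2) x], of t] t
    unfolding yeq[symmetric] by simp
  also have "t * g z \<le> t * B" using B zw t by simp
  also have "\<rho> * min t (1 - t) * r powr (1 + \<nu>) \<le> \<rho> * t * (2 * r) powr (1 + \<nu>)"
    using t assms K by (intro mult_mono) auto
  finally have up: "g y - g x \<le> t * (B - g x + \<rho> * (2 * r) powr (1 + \<nu>))"
    by (simp add: algebra_simps)
  \<comment> \<open>The weight \<open>s\<close> is the one for which \<open>x\<close> is a convex combination of \<open>w\<close> and \<open>y\<close>.\<close>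
  define s where "s = t / (1 + t)"
  have s: "0 < s" "s \<le> 1" "1 - s = 1 / (1 + t)" using t by (auto simp: s_def field_simps)
  have "s *\<^sub>R w + (1 - s) *\<^sub>R y = x + ((1 - s) - s / t) *\<^sub>R (y - x)"
    by (simp add: w_def algebra_simps)
  also have "(1 - s) - s / t = 0" using t by (simp add: s(3)) (simp add: s_def)
  finally have xeq: "x = s *\<^sub>R w + (1 - s) *\<^sub>R y" by simp
  have wy: "norm (w - y) \<le> 2 * r"
    using zw y norm_triangle_ineq4[of "w - x" "y - x"] by (auto simp: dist_norm norm_minus_commute)
  have "g x \<le> s * g w + (1 - s) * g y + \<rho> * min s (1 - s) * norm (w - y) powr (1 + \<nu>)"
    using paraconvex_on_realD[OF pc subsetD[OF r(2) zw(2)] subsetD[OF r(2) y], of s] s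
    unfolding xeq[symmetric] by simp
  also have "s * g w \<le> s * B" using B zw s by simp
  also have "\<rho> * min s (1 - s) * norm (w - y) powr (1 + \<nu>) \<le> \<rho> * s * (2 * r) powr (1 + \<nu>)"
    using s t assms wy by (intro mult_mono powr_mono2) auto
  finally have "(1 + t) * g x \<le> (1 + t) * (s * B + (1 - s) * g y + \<rho> * s * (2 * r) powr (1 + \<nu>))"
    using t by (intro mult_left_mono) auto
  also have "\<dots> = ((1 + t) * s) * B + ((1 + t) * (1 - s)) * g y + \<rho> * ((1 + t) * s) * (2 * r) powr (1 + \<nu>)"
    by (simp add: algebra_simps)
  also have "(1 + t) * s = t" using t by (simp add: s_def)
  also have "(1 + t) * (1 - s) = 1" using t by (simp add: s(3))
  finally have "g x - g y \<le> t * (B - g x + \<rho> * (2 * r) powr (1 + \<nu>))"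
    by (simp add: algebra_simps)
  then show ?thesis using up unfolding t_def by linarith
qed

text \<open>In finite dimension a box around \<open>x\<close> is the hull of its finitely many vertices, so the two
  preceding lemmas apply.\<close>

lemma paraconvex_continuous_on:
  fixes g :: "'a::euclidean_space \<Rightarrow> real"
  assumes pc: "paraconvex_on S \<nu> \<rho> (\<lambda>z. ereal (g z))" and "\<rho> \<ge> 0" "\<nu> \<ge> 0" "open S"
  shows "continuous_on S g"
proof -
  have "(g \<longlongrightarrow> g x) (at x)" if x: "x \<in> S" for x
  proof -
    obtain a b where ab: "cbox a b \<subseteq> S" "x \<in> box a b"
      using open_contains_cbox[OF assms(4) x] by metis
    obtain T where T: "finite T" "cbox a b = convex hull T"
      by (rule closed_interval_as_convex_hull)
    obtain B where B: "\<And>z. z \<in> cbox a b \<Longrightarrow> g z \<le> B"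
      using paraconvex_bounded_above_on_convex_hull[OF T(1) pc] assms ab T by auto
    obtain r where r: "r > 0" "cball x r \<subseteq> box a b"
      using ab(2) open_box open_contains_cball by metis
    then have sub: "cball x r \<subseteq> cbox a b" using box_subset_cbox by blast
    define M where "M = B - g x + \<rho> * (2 * r) powr (1 + \<nu>)"
    have "norm (g y - g x) \<le> norm (y - x) / r * M" if "y \<in> ball x r" for y
      unfolding M_def real_norm_def
      by (rule paraconvex_local_lipschitz_at[OF pc assms(2,3) r(1)])
        (use sub ab(1) B that in \<open>auto intro: less_imp_le\<close>)
    then have "\<forall>\<^sub>F y in at x. norm (g y - g x) \<le> norm (y - x) / r * M"
      using eventually_at_in_open'[of "ball x r" x] r(1) by (auto elim: eventually_mono)
    moreover have "((\<lambda>y. norm (y - x) / r * M) \<longlongrightarrow> norm (x - x) / r * M) (at x)"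
      using r(1) by (intro tendsto_intros) auto
    then have "((\<lambda>y. norm (y - x) / r * M) \<longlongrightarrow> 0) (at x)" by simp
    ultimately have "((\<lambda>y. g y - g x) \<longlongrightarrow> 0) (at x)"
      by (rule Lim_null_comparison)
    then show ?thesis by (simp add: LIM_zero_iff)
  qed
  then show ?thesis
    by (simp add: continuous_on_eq_continuous_at[OF assms(4)] isCont_def)
qed

section \<open>The subgradient inequality\<close>

text \<open>For base points \<open>y\<close> near \<open>x\<close>, paraconvexity on the segment from \<open>y\<close> to \<open>y + v\<close> bounds
  every difference quotient with \<open>0 < t < 1\<close> by \<open>g (y + v) - g y + \<rho> \<parallel>v\<parallel>\<^sup>1\<^sup>+\<^sup>\<nu>\<close>, independently
  of \<open>t\<close>. Continuity at both ends of the segment then lets \<open>y\<close> tend to \<open>x\<close>.\<close>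

lemma clarke_dd_le_paraconvex:
  fixes f :: "'a::euclidean_space \<Rightarrow> ereal"
  assumes pc: "paraconvex_on S \<nu> \<rho> (\<lambda>z. ereal (g z))" and "\<rho> \<ge> 0" "\<nu> \<ge> 0" "open S" "convex S"
    and f: "\<And>z. z \<in> S \<Longrightarrow> f z = ereal (g z)"
    and x: "x \<in> S" "x + v \<in> S"
  shows "clarke_dd f x v \<le> ereal (g (x + v) - g x + \<rho> * norm v powr (1 + \<nu>))"
proof (rule ereal_le_epsilon2)
  fix e :: real assume e: "e > 0"
  have cont: "isCont g z" if "z \<in> S" for z
    using paraconvex_continuous_on[OF pc assms(2-4)] that assms(4)
    by (simp add: continuous_on_eq_continuous_at)
  have tsh: "((\<lambda>y. y + v) \<longlongrightarrow> x + v) (nhds x)"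
    by (intro tendsto_intros) (simp add: filterlim_def)
  have "((\<lambda>y. g (y + v) - g y) \<longlongrightarrow> g (x + v) - g x) (nhds x)"
    by (intro tendsto_diff isCont_tendsto_compose[OF cont tsh] isCont_tendsto_compose[OF cont] x)
       (simp add: filterlim_def)
  then have "\<forall>\<^sub>F y in nhds x. g (y + v) - g y < g (x + v) - g x + e"
    using e by (intro order_tendstoD) auto
  moreover have "\<forall>\<^sub>F y in nhds x. y \<in> S" 
    using assms(4) x by (simp add: eventually_nhds_in_open)
  moreover have "\<forall>\<^sub>F y in nhds x. y + v \<in> S"
    using topological_tendstoD[OF tsh assms(4)] x by blast
  ultimately have ev: "\<forall>\<^sub>F y in nhds x. g (y + v) - g y < g (x + v) - g x + e \<and> y \<in> S \<and> y + v \<in> S"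
    by eventually_elim auto
  have ev2: "\<forall>\<^sub>F t in at_right (0::real). 0 < t \<and> t < 1"
    using eventually_at_right_real[of 0 "1::real"] by simp
  have key: "(f (y + t *\<^sub>R v) - f y) / ereal t
      \<le> ereal (g (x + v) - g x + \<rho> * norm v powr (1 + \<nu>)) + ereal e"
    if y: "g (y + v) - g y < g (x + v) - g x + e" "y \<in> S" "y + v \<in> S" and t: "0 < t" "t < 1" for y t
  proof -
    have eq: "y + t *\<^sub>R v = t *\<^sub>R (y + v) + (1 - t) *\<^sub>R y" by (simp add: algebra_simps)
    have S: "y + t *\<^sub>R v \<in> S" unfolding eq using assms(5) y t by (intro convexD) auto
    have "g (y + t *\<^sub>R v) \<le> t * g (y + v) + (1 - t) * g y + \<rho> * min t (1 - t) * norm v powr (1 + \<nu>)"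
      unfolding eq using paraconvex_on_realD[OF pc, of "y + v" y t] y t by simp
    also have "\<rho> * min t (1 - t) * norm v powr (1 + \<nu>) \<le> \<rho> * t * norm v powr (1 + \<nu>)"
      using assms(2) by (intro mult_right_mono mult_left_mono) auto
    finally have "g (y + t *\<^sub>R v) - g y \<le> t * (g (y + v) - g y + \<rho> * norm v powr (1 + \<nu>))"
      by (simp add: algebra_simps)
    then have "(g (y + t *\<^sub>R v) - g y) / t \<le> g (y + v) - g y + \<rho> * norm v powr (1 + \<nu>)"
      using t by (simp add: divide_le_eq mult.commute)
    also have "\<dots> \<le> g (x + v) - g x + \<rho> * norm v powr (1 + \<nu>) + e" using y by simp
    finally show ?thesis using f[OF S] f[OF y(2)] t by simp
  qed
  show "clarke_dd f x v \<le> ereal (g (x + v) - g x + \<rho> * norm v powr (1 + \<nu>)) + ereal e"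
    unfolding clarke_dd_def
    by (intro Limsup_bounded eventually_mono[OF eventually_prodI[OF ev ev2]])
      (use key in \<open>auto simp: split_beta\<close>)
qed

lemma paraconvex_subgradient_inequality:
  fixes f :: "'a::euclidean_space \<Rightarrow> ereal"
  assumes "paraconvex_on S \<nu> \<rho> (\<lambda>z. ereal (g z))" "\<rho> \<ge> 0" "\<nu> \<ge> 0" "open S" "convex S"
    and "\<And>z. z \<in> S \<Longrightarrow> f z = ereal (g z)"
    and "x \<in> S" "y \<in> S" "\<zeta> \<in> clarke_subdiff f x"
  shows "g x - g y - \<rho> * norm (x - y) powr (1 + \<nu>) \<le> \<zeta> \<bullet> (x - y)"
proof -
  have "ereal (\<zeta> \<bullet> (y - x)) \<le> clarke_dd f x (y - x)"
    using assms(9) by (simp add: clarke_subdiff_def)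
  also have "\<dots> \<le> ereal (g (x + (y - x)) - g x + \<rho> * norm (y - x) powr (1 + \<nu>))"
    using assms by (intro clarke_dd_le_paraconvex) auto
  finally show ?thesis by (simp add: inner_diff_right norm_minus_commute)
qed

section \<open>One step of the method\<close>

text \<open>The projection fixes \<open>p\<close> and is nonexpansive, so the new distance is at most the distance from
  the unprojected point to \<open>p\<close>, whose square is expanded. The normalised step enters through
  \<open>\<zeta> \<bullet> (x - p) / \<parallel>\<zeta>\<parallel> \<ge> c d / L\<close>.\<close>

lemma infdist_projected_step_le:
  fixes x p \<zeta> :: "'a::euclidean_space"
  assumes X: "closed X" "convex X" "M \<subseteq> X" and p: "p \<in> M" "dist x p = infdist x M"
    and "c > 0" "\<alpha> \<ge> 0" "\<zeta> \<noteq> 0" "norm \<zeta> \<le> L"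
    and ineq: "c * infdist x M \<le> \<zeta> \<bullet> (x - p)"
  shows "(infdist (closest_point X (x - (\<alpha> / norm \<zeta>) *\<^sub>R \<zeta>)) M)\<^sup>2
          \<le> (infdist x M)\<^sup>2 - 2 * (c / L) * \<alpha> * infdist x M + \<alpha>\<^sup>2"
proof -
  define y where "y = x - (\<alpha> / norm \<zeta>) *\<^sub>R \<zeta>"
  define d where "d = infdist x M"
  have d: "0 \<le> d" by (simp add: d_def infdist_nonneg)
  have pX: "p \<in> X" using X p by auto
  then have "dist (closest_point X y) (closest_point X p) \<le> dist y p"
    using X by (intro closest_point_lipschitz) auto
  then have "dist (closest_point X y) p \<le> dist y p"
    using pX by (simp add: closest_point_self)
  with infdist_le[OF p(1), of "closest_point X y"]
  have "infdist (closest_point X y) M \<le> norm (y - p)" by (simp add: dist_norm)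
  then have "(infdist (closest_point X y) M)\<^sup>2 \<le> (norm (y - p))\<^sup>2"
    by (intro power_mono) (auto simp: infdist_nonneg)
  also have "y - p = (x - p) - (\<alpha> / norm \<zeta>) *\<^sub>R \<zeta>" by (simp add: y_def)
  also have "(norm ((x - p) - (\<alpha> / norm \<zeta>) *\<^sub>R \<zeta>))\<^sup>2
      = (norm (x - p))\<^sup>2 - 2 * \<alpha> * ((\<zeta> \<bullet> (x - p)) / norm \<zeta>) + \<alpha>\<^sup>2"
  proof -
    define c where "c = \<alpha> / norm \<zeta>"
    have "(norm ((x - p) - c *\<^sub>R \<zeta>))\<^sup>2 = (norm (x - p))\<^sup>2 - 2 * c * (\<zeta> \<bullet> (x - p)) + (c * norm \<zeta>)\<^sup>2"
      unfolding power_mult_distrib power2_norm_eq_inner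
      by (simp add: inner_diff_left inner_diff_right inner_commute algebra_simps power2_eq_square)
    then show ?thesis using \<open>\<zeta> \<noteq> 0\<close> by (simp add: c_def)
  qed
  also have "norm (x - p) = d" using p by (simp add: d_def dist_norm)
  finally have "(infdist (closest_point X y) M)\<^sup>2
      \<le> d\<^sup>2 - 2 * \<alpha> * ((\<zeta> \<bullet> (x - p)) / norm \<zeta>) + \<alpha>\<^sup>2" .
  moreover have "2 * \<alpha> * (c / L * d) \<le> 2 * \<alpha> * ((\<zeta> \<bullet> (x - p)) / norm \<zeta>)"
  proof -
    have "c * d / L \<le> c * d / norm \<zeta>"
      using assms d by (intro divide_left_mono mult_pos_pos) (auto intro: less_le_trans[of _ "norm \<zeta>"])
    also have "\<dots> \<le> (\<zeta> \<bullet> (x - p)) / norm \<zeta>"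
      using ineq by (intro divide_right_mono) (auto simp: d_def)
    finally show ?thesis using assms(7) by (intro mult_left_mono) auto
  qed
  ultimately show ?thesis by (simp add: y_def d_def algebra_simps)
qed

text \<open>A convex quadratic in \<open>d\<close> on \<open>[0, B]\<close> is bounded by its values at the endpoints.\<close>

lemma geometric_step:
  fixes d \<tau> \<alpha> B q :: real
  assumes "0 \<le> d" "d \<le> B" "\<alpha>\<^sup>2 \<le> (B * q)\<^sup>2" "B\<^sup>2 - \<tau> * \<alpha> * B + \<alpha>\<^sup>2 \<le> (B * q)\<^sup>2"
  shows "d\<^sup>2 - \<tau> * \<alpha> * d + \<alpha>\<^sup>2 \<le> (B * q)\<^sup>2"
proof (cases "d - \<tau> * \<alpha> \<le> 0")
  case True
  then have "d * (d - \<tau> * \<alpha>) \<le> 0" using assms by (simp add: mult_nonneg_nonpos)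
  then show ?thesis using assms by (simp add: algebra_simps power2_eq_square)
next
  case False
  then have "d * (d - \<tau> * \<alpha>) \<le> B * (B - \<tau> * \<alpha>)" using assms by (intro mult_mono) auto
  then show ?thesis using assms by (simp add: algebra_simps power2_eq_square)
qed

text \<open>In the half tube, where \<open>\<rho> d\<^sup>\<nu> \<le> \<mu> / 2\<close>, the paraconvexity error absorbs at most half of
  the sharp growth \<open>\<mu> d\<close>.\<close>

lemma sharp_paraconvex_inner_ge:
  fixes d :: real
  assumes "\<mu> > 0" "\<rho> > 0" "\<nu> > 0" "0 \<le> d" "d \<le> (\<mu> / (2 * \<rho>)) powr (1 / \<nu>)"
    and "\<mu> * d - \<rho> * d powr (1 + \<nu>) \<le> c"
  shows "\<mu> / 2 * d \<le> c"
proof (cases "d = 0")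
  case False
  have "d powr \<nu> \<le> ((\<mu> / (2 * \<rho>)) powr (1 / \<nu>)) powr \<nu>"
    using assms by (intro powr_mono2) auto
  also have "\<dots> = \<mu> / (2 * \<rho>)" using assms by (simp add: powr_powr)
  finally have "\<rho> * d powr \<nu> \<le> \<mu> / 2" using assms by (simp add: field_simps)
  then have "(\<rho> * d powr \<nu>) * d \<le> \<mu> / 2 * d" using assms by (intro mult_right_mono) auto
  moreover have "d powr (1 + \<nu>) = d powr \<nu> * d" using assms by (simp add: powr_add)
  ultimately show ?thesis using assms(6) by (simp add: mult.assoc)
qed (use assms in auto)

section \<open>Linear convergence\<close>

text \<open>With \<open>1 - q\<^sup>2 = (1 - 2 \<beta>) \<tau>\<^sup>2 / 4\<close> the discriminant \<open>\<tau>\<^sup>2 - 4 (1 - q\<^sup>2)\<close> is \<open>2 \<beta> \<tau>\<^sup>2\<close>, a square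
  \<open>(s \<tau>)\<^sup>2\<close> with \<open>0 < s < 1\<close>. The last inequality then says that \<open>A\<close> lies in the interval from
  \<open>2 \<lambda> / (\<tau> (1 + s))\<close> to \<open>2 \<lambda> / (\<tau> (1 - s))\<close>, and both arguments of the maximum defining \<open>A\<close> are at
  most the right endpoint. The lower bound on \<open>\<beta>\<close>, rewritten as \<open>(5 - 2 \<beta>) \<tau>\<^sup>2 < 4\<close>,
  gives \<open>\<tau>\<^sup>2 \<le> 4 q\<^sup>2\<close>, hence \<open>4 \<lambda>\<^sup>2 \<le> A\<^sup>2 \<tau>\<^sup>2 \<le> 4 A\<^sup>2 q\<^sup>2\<close>.\<close>

lemma geometric_rate_conditions:
  fixes \<tau> \<beta> lam A q d0 :: real
  assumes "\<tau> > 0" and "(5 * \<tau>\<^sup>2 - 4) / (2 * \<tau>\<^sup>2) < \<beta>" "0 < \<beta>" "\<beta> < 1 / 2" "lam > 0"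
    and q: "q = sqrt (1 - (1 - 2 * \<beta>) * \<tau>\<^sup>2 / 4)"
    and A: "A = max (2 * lam / \<tau>) d0"
    and d0: "d0 \<le> 2 * lam / (\<tau> - sqrt (\<tau>\<^sup>2 - 4 * (1 - q\<^sup>2)))"
  shows "0 < q" "q < 1" "lam\<^sup>2 \<le> (A * q)\<^sup>2" "A\<^sup>2 - \<tau> * lam * A + lam\<^sup>2 \<le> (A * q)\<^sup>2"
proof -
  have tau2: "\<tau>\<^sup>2 > 0" using assms by simp
  have b1: "5 * \<tau>\<^sup>2 - 4 < 2 * \<beta> * \<tau>\<^sup>2"
    using assms(2) tau2 by (simp add: divide_less_eq algebra_simps)
  have bt: "0 < \<beta> * \<tau>\<^sup>2" "\<beta> * \<tau>\<^sup>2 < 1 / 2 * \<tau>\<^sup>2"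
    using assms tau2 by (auto intro: mult_strict_right_mono)
  have q2: "q\<^sup>2 = 1 - (1 - 2 * \<beta>) * \<tau>\<^sup>2 / 4" and qpos: "0 < q"
    using b1 bt unfolding q by (auto simp: algebra_simps)
  show "0 < q" by fact
  have "q\<^sup>2 < 1\<^sup>2" unfolding q2 using bt by (simp add: algebra_simps)
  then show "q < 1" by (rule power_less_imp_less_base) simp
  define s where "s = sqrt (2 * \<beta>)"
  have s: "s\<^sup>2 = 2 * \<beta>" "0 < s" "s < 1"
    using assms by (auto simp: s_def)
  have "\<tau>\<^sup>2 - 4 * (1 - q\<^sup>2) = (s * \<tau>)\<^sup>2"
    unfolding q2 power_mult_distrib s(1) by (simp add: field_simps)
  then have sq: "sqrt (\<tau>\<^sup>2 - 4 * (1 - q\<^sup>2)) = s * \<tau>"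
    using s assms by simp
  have Al: "2 * lam \<le> A * \<tau>"
    using assms(1) A by (simp add: pos_divide_le_eq[symmetric])
  have "A \<le> 2 * lam / (\<tau> * (1 - s))"
  proof -
    have "2 * lam / \<tau> \<le> 2 * lam / (\<tau> * (1 - s))"
      using assms s by (intro divide_left_mono mult_pos_pos) auto
    moreover have "d0 \<le> 2 * lam / (\<tau> * (1 - s))"
      using d0 unfolding sq by (simp add: algebra_simps)
    ultimately show ?thesis using A by simp
  qed
  then have Au: "A * \<tau> * (1 - s) \<le> 2 * lam"
    using pos_le_divide_eq[of "\<tau> * (1 - s)" A "2 * lam"] assms(1) s(3) by (simp add: mult.assoc)
  have "4 * lam\<^sup>2 = (2 * lam)\<^sup>2" by (simp add: power2_eq_square)
  also have "\<dots> \<le> (A * \<tau>)\<^sup>2" using Al assms by (intro power_mono) auto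
  also have "\<dots> = A\<^sup>2 * \<tau>\<^sup>2" by (simp add: power_mult_distrib)
  also have "\<dots> \<le> A\<^sup>2 * (4 * q\<^sup>2)"
    unfolding q2 using b1 bt by (intro mult_left_mono) (auto simp: field_simps)
  finally show "lam\<^sup>2 \<le> (A * q)\<^sup>2" by (simp add: power_mult_distrib)
  \<comment> \<open>The product of the two root conditions is the quadratic inequality, up to the factor \<open>-4\<close>.\<close>
  have "0 \<le> s * (A * \<tau>)" using Al assms s by simp
  then have "0 \<le> (A * \<tau> * (1 + s) - 2 * lam) * (2 * lam - A * \<tau> * (1 - s))"
    using Al Au by (intro mult_nonneg_nonneg) (auto simp: algebra_simps)
  also have "\<dots> = 4 * \<tau> * lam * A - 4 * lam\<^sup>2 - A\<^sup>2 * \<tau>\<^sup>2 * (1 - s\<^sup>2)"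
    by (simp add: algebra_simps power2_eq_square)
  also have "A\<^sup>2 * \<tau>\<^sup>2 * (1 - s\<^sup>2) = 4 * (A\<^sup>2 - (A * q)\<^sup>2)"
  proof -
    have "\<tau>\<^sup>2 * (1 - s\<^sup>2) = 4 * (1 - q\<^sup>2)" unfolding q2 s(1) by simp
    then show ?thesis by (simp add: power_mult_distrib mult.assoc) (simp add: algebra_simps)
  qed
  finally show "A\<^sup>2 - \<tau> * lam * A + lam\<^sup>2 \<le> (A * q)\<^sup>2" by simp
qed

theorem theorem4p10:
  fixes f :: "real ^ 'n \<Rightarrow> ereal"
    and X X' :: "(real ^ 'n) set"
    and x :: "nat \<Rightarrow> real ^ 'n"
    and \<rho> \<nu> \<delta> \<mu> L \<tau> \<beta> lam q A :: real
  assumes "proper_fun f"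
    and "X \<noteq> {}" and "closed X" and "convex X" and "X \<subseteq> effective_domain f"
    and "minimizers f X \<noteq> {}"
    and "\<rho> > 0" and "0 < \<nu>" and "\<nu> \<le> 1" and "\<mu> > 0"
    and "1 / (1 + \<nu>) < \<delta>" and "\<delta> \<le> 1"
    and "open X'" and "convex X'" and "X \<subseteq> X'" and "X' \<subseteq> effective_domain f"
    and "paraconvex_on X' \<nu> \<rho> f"
    and "holder_error_bound f X \<delta> \<mu>"
    and "ereal L = Sup {ereal (norm \<zeta>) | \<zeta> z. z \<in> tube f X \<nu> \<rho> \<delta> \<mu> 1 \<and> \<zeta> \<in> clarke_subdiff f z}"
    and "0 < L"
    and "\<delta> = 1"
    and "\<tau> = \<mu> / L" and "\<tau> \<noteq> 1"
    and "max ((5 * \<tau>\<^sup>2 - 4) / (2 * \<tau>\<^sup>2)) 0 < \<beta>" and "\<beta> < 1 / 2"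
    and "0 < lam" and "lam < \<tau> / 2 * (\<mu> / (2 * \<rho>)) powr (1 / \<nu>)"
    and "x 0 \<in> tube f X \<nu> \<rho> \<delta> \<mu> (1 / 2)"
    and "q = sqrt (1 - (1 - 2 * \<beta>) * \<tau>\<^sup>2 / 4)"
    and "A = max (2 * lam / \<tau>) (infdist (x 0) (minimizers f X))"
    and "projected_subgradient f X (\<lambda>k. lam * q ^ k) x"
    and "infdist (x 0) (minimizers f X) \<le> 2 * lam / (\<tau> - sqrt (\<tau>\<^sup>2 - 4 * (1 - q\<^sup>2)))"
  shows "\<forall>k. infdist (x k) (minimizers f X) \<le> A * q ^ k"
proof -
  define g where "g = (\<lambda>z. real_of_ereal (f z))"
  define M where "M = minimizers f X"
  define R where "R = (\<mu> / (2 * \<rho>)) powr (1 / \<nu>)"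
  have fin: "\<bar>f z\<bar> \<noteq> \<infinity>" if "z \<in> X'" for z
    using assms(1,16) that unfolding proper_fun_def effective_domain_def by force
  then have fg: "f z = ereal (g z)" if "z \<in> X'" for z
    using that unfolding g_def by (simp add: ereal_real')
  have pc: "paraconvex_on X' \<nu> \<rho> (\<lambda>z. ereal (g z))"
    unfolding g_def by (rule paraconvex_on_real_of_ereal[OF assms(17,14) fin])
  have cont: "continuous_on X g"
    using paraconvex_continuous_on[OF pc _ _ assms(13)] assms(7,8,15) continuous_on_subset by force

  obtain p0 where p0: "p0 \<in> M" using assms(6) M_def by blast
  have MX: "M \<subseteq> X" by (auto simp: M_def minimizers_def is_arg_min_def)
  have M_iff: "z \<in> M \<longleftrightarrow> z \<in> X \<and> (\<forall>y\<in>X. g z \<le> g y)" for z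
    using fg assms(15) unfolding M_def minimizers_def is_arg_min_linorder
    by (auto simp: subset_eq)
  then have "M = {z \<in> X. g z = g p0}" using p0 by (auto intro: antisym)
  then have M: "closed M"
    using continuous_closed_preimage_constant[OF cont assms(3)] by simp
  have min_val: "min_value f X = ereal (g p)" if "p \<in> M" for p
    unfolding min_value_def
  proof (rule antisym)
    show "(INF z\<in>X. f z) \<le> ereal (g p)"
      using that MX assms(15) fg by (intro INF_lower2[of p]) auto
    show "ereal (g p) \<le> (INF z\<in>X. f z)"
      using that M_iff assms(15) fg by (intro INF_greatest) (auto simp: subset_eq)
  qed
  have sharp: "\<mu> * infdist z M \<le> g z - g p" if "z \<in> X" "p \<in> M" for z p
    using assms(18) that fg[of z] assms(15,21) min_val[OF that(2)] infdist_nonneg[of z M]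
    unfolding holder_error_bound_def M_def[symmetric] by (auto simp: subset_eq)
  have tube_eq: "tube f X \<nu> \<rho> \<delta> \<mu> c = {z \<in> X. infdist z M < (c * \<mu> / \<rho>) powr (1 / \<nu>)}" for c
    unfolding tube_def M_def assms(21) by simp
  have R1: "R \<le> (1 * \<mu> / \<rho>) powr (1 / \<nu>)"
    unfolding R_def using assms(7,8,10) by (intro powr_mono2) (auto simp: field_simps)
  have norm_le: "norm \<zeta> \<le> L" if "z \<in> X" "infdist z M < R" "\<zeta> \<in> clarke_subdiff f z" for z \<zeta>
  proof -
    have "z \<in> tube f X \<nu> \<rho> \<delta> \<mu> 1" using that(1,2) R1 by (simp add: tube_eq)
    then have "ereal (norm \<zeta>) \<le> ereal L"
      unfolding assms(19) using that(3) by (intro Sup_upper) blast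
    then show ?thesis by simp
  qed

  have tau: "\<tau> > 0" using assms(10,20,22) by simp
  note rate = geometric_rate_conditions[OF tau _ _ assms(25,26,29,30,32)]
  have q: "0 < q" "q < 1" and A1: "lam\<^sup>2 \<le> (A * q)\<^sup>2"
    and A2: "A\<^sup>2 - \<tau> * lam * A + lam\<^sup>2 \<le> (A * q)\<^sup>2"
    using rate assms(24) by auto
  have "infdist (x 0) M < R"
    using assms(28) unfolding tube_eq R_def by simp
  moreover have "2 * lam / \<tau> < R"
    using assms(27) tau unfolding R_def by (simp add: field_simps)
  ultimately have AR: "A < R" unfolding assms(30) M_def by simp
  have A0: "0 \<le> A" using infdist_nonneg[of "x 0" M] unfolding assms(30) M_def by simp

  have "x k \<in> X \<and> infdist (x k) M \<le> A * q ^ k" for k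
  proof (induction k)
    case 0
    then show ?case using assms(28,30) by (simp add: tube_eq M_def)
  next
    case (Suc k)
    define d where "d = infdist (x k) M"
    define \<alpha> where "\<alpha> = lam * q ^ k"
    have xk: "x k \<in> X" and d: "0 \<le> d" "d \<le> A * q ^ k"
      using Suc by (auto simp: d_def infdist_nonneg)
    have "A * q ^ k \<le> A * 1" using A0 q by (intro mult_left_mono power_le_one) auto
    then have dR: "d < R" using d AR by simp
    obtain p where p: "p \<in> M" "dist (x k) p = infdist (x k) M"
      by (rule infdist_attains_inf[OF M, of "x k"]) (use p0 in auto)
    obtain \<zeta> where \<zeta>: "\<zeta> \<in> clarke_subdiff f (x k)"
      and step: "x (Suc k) = (if \<zeta> = 0 then x k else closest_point X (x k - (\<alpha> / norm \<zeta>) *\<^sub>R \<zeta>))"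
      using assms(31) unfolding projected_subgradient_def \<alpha>_def by blast
    have "g (x k) - g p - \<rho> * norm (x k - p) powr (1 + \<nu>) \<le> \<zeta> \<bullet> (x k - p)"
      by (rule paraconvex_subgradient_inequality[OF pc _ _ assms(13,14) fg _ _ \<zeta>])
         (use xk p MX assms(7,8,15) in auto)
    then have "\<mu> * d - \<rho> * d powr (1 + \<nu>) \<le> \<zeta> \<bullet> (x k - p)"
      using sharp[OF xk p(1)] p(2) by (simp add: d_def dist_norm)
    then have inner: "\<mu> / 2 * d \<le> \<zeta> \<bullet> (x k - p)"
      using sharp_paraconvex_inner_ge[OF assms(10,7,8) d(1)] dR by (simp add: R_def)
    show ?case
    proof (cases "\<zeta> = 0")
      case True
      \<comment> \<open>A zero subgradient in the half tube forces \<open>x k\<close> to be a minimizer.\<close>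
      then have "d = 0" using inner d assms(10) by (simp add: mult_le_0_iff)
      then show ?thesis using step True xk A0 q by (simp add: d_def)
    next
      case False
      have "(infdist (x (Suc k)) M)\<^sup>2 \<le> d\<^sup>2 - 2 * ((\<mu> / 2) / L) * \<alpha> * d + \<alpha>\<^sup>2"
        unfolding step d_def using False
        by (simp only: if_False)
           (rule infdist_projected_step_le[OF assms(3,4) MX p],
             use False inner norm_le[OF xk _ \<zeta>] dR assms(10,26) q in \<open>auto simp: d_def \<alpha>_def\<close>)
      also have "\<dots> = d\<^sup>2 - \<tau> * \<alpha> * d + \<alpha>\<^sup>2" by (simp add: assms(22))
      also have "\<dots> \<le> ((A * q ^ k) * q)\<^sup>2"
      proof (rule geometric_step[OF d])
        have "(q ^ k)\<^sup>2 * lam\<^sup>2 \<le> (q ^ k)\<^sup>2 * (A * q)\<^sup>2"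
          using A1 by (intro mult_left_mono) auto
        then show "\<alpha>\<^sup>2 \<le> (A * q ^ k * q)\<^sup>2"
          by (simp add: \<alpha>_def power_mult_distrib mult_ac)
        have "(q ^ k)\<^sup>2 * (A\<^sup>2 - \<tau> * lam * A + lam\<^sup>2) \<le> (q ^ k)\<^sup>2 * (A * q)\<^sup>2"
          using A2 by (intro mult_left_mono) auto
        then show "(A * q ^ k)\<^sup>2 - \<tau> * \<alpha> * (A * q ^ k) + \<alpha>\<^sup>2 \<le> (A * q ^ k * q)\<^sup>2"
          by (simp add: \<alpha>_def power2_eq_square algebra_simps)
      qed
      finally have "infdist (x (Suc k)) M \<le> A * q ^ k * q"
        by (rule power2_le_imp_le) (use A0 q in auto)
      moreover have "x (Suc k) \<in> X"
        using step False assms(2,3) by (simp add: closest_point_in_set)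
      ultimately show ?thesis by (simp add: mult_ac)
    qed
  qed
  then show ?thesis unfolding M_def by blast
qed

end
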